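(* Let $d\ge 1$ and let $X=(X_1,\dots,X_d)$ be a random variable in $\mathbb{R}^d$ generated by the additive noise model $$X_i=f_i(\mathrm{pa}_i(X))+\epsilon_i,\qquad i=1,\dots,d,$$ over a directed acyclic graph $\mathcal{G}$ on $\{1,\dots,d\}$, where $\mathrm{pa}_i(X)$ denotes the sub-vector of $X$ of coordinates that are parents of $i$ in $\mathcal{G}$, each $f_i$ is twice continuously differentiable and non-linear in every component (as defined in the context), and the noise variables $\epsilon_1,\dots,\epsilon_d$ are i.i.d. with smooth probability density function $p^\epsilon$ on $\mathbb{R}$. Let $p$ be the density of $X$ and $s(x)=\nabla\log p(x)$ its score function, defined at all points $x$ with $p(x)>0$. Then for every $j\in\{1,\dots,d\}$ and every $x\in\mathbb{R}^d$ with $p(x)>0$, $$s_j(x)=\frac{d\log p^\epsilon}{dx}\bigl(x_j-f_j(\mathrm{pa}_j(x))\bigr)-\sum_{i\in\mathrm{children}(j)}\frac{\partial f_i}{\partial x_j}(\mathrm{pa}_i(x))\,\frac{d\log p^\epsilon}{dx}\bigl(x_i-f_i(\mathrm{pa}_i(x))\bigr),$$ where $\frac{d\log p^\epsilon}{dx}(u)$ denotes the derivative of the univariate function $\log p^\epsilon$ evaluated at the point $u$.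
   Context: $\mathrm{children}(j)$ is the set of nodes $i$ such that $j$ is a parent of $i$ in $\mathcal{G}$. For $x\in\mathbb{R}^d$, $\mathrm{pa}_i(x)$ is the sub-vector of $x$ formed by the coordinates that are parents of $i$. Non-linear in every component: if the parents of node $j$ are $k_1,\dots,k_l$, then for every $a\in\{1,\dots,l\}$ there exist values $(x_{k_1},\dots,x_{k_{a-1}},x_{k_{a+1}},\dots,x_{k_l})\in\mathbb{R}^{l-1}$ such that the univariate function $t\mapsto f_j(x_{k_1},\dots,x_{k_{a-1}},t,x_{k_{a+1}},\dots,x_{k_l})$ is non-linear, meaning not of the form $t\mapsto \alpha t+\beta$. If $j$ has no parents, $f_j$ is a constant. *)

theory Defs
  imports "HOL-Probability.Probability"
begin

text \<open>
  A directed graph on the index type is its edge set; \<open>(k, i) \<in> E\<close> means that \<open>k\<close> is a parent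
  of \<open>i\<close>.
\<close>

definition parents :: "('n \<times> 'n) set \<Rightarrow> 'n \<Rightarrow> 'n set" where
  "parents E i = {k. (k, i) \<in> E}"

definition children :: "('n \<times> 'n) set \<Rightarrow> 'n \<Rightarrow> 'n set" where
  "children E j = {i. j \<in> parents E i}"

text \<open>
  The space of vectors with coordinates indexed by \<open>I\<close> consists of the extensional functions on
  \<open>I\<close>. As a subspace of the product topology on \<open>'n \<Rightarrow> real\<close> it carries, for finite \<open>I\<close>, the
  Euclidean topology. For empty \<open>I\<close> it is a single point, so that a function of no parents is a
  constant.
\<close>

abbreviation subvectors :: "'n set \<Rightarrow> ('n \<Rightarrow> real) set" where
  "subvectors I \<equiv> I \<rightarrow>\<^sub>E UNIV"

definition pa :: "('n \<times> 'n) set \<Rightarrow> 'n \<Rightarrow> real ^ 'n \<Rightarrow> 'n \<Rightarrow> real" where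
  "pa E i x = restrict (\<lambda>k. x $ k) (parents E i)"

definition partial_deriv :: "'n \<Rightarrow> (('n \<Rightarrow> real) \<Rightarrow> real) \<Rightarrow> ('n \<Rightarrow> real) \<Rightarrow> real" where
  "partial_deriv j g v = deriv (\<lambda>t. g (v(j := t))) (v j)"

text \<open>
  All partial derivatives up to order \<open>m\<close> exist and are continuous, on the whole space of vectors
  indexed by \<open>I\<close>.
\<close>

primrec continuously_differentiable :: "nat \<Rightarrow> 'n set \<Rightarrow> (('n \<Rightarrow> real) \<Rightarrow> real) \<Rightarrow> bool" where
  "continuously_differentiable 0 I g \<longleftrightarrow> continuous_on (subvectors I) g"
| "continuously_differentiable (Suc m) I g \<longleftrightarrow>
     continuous_on (subvectors I) g \<and>
     (\<forall>j\<in>I. (\<forall>v\<in>subvectors I. (\<lambda>t. g (v(j := t))) differentiable at (v j)) \<and>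
            continuously_differentiable m I (partial_deriv j g))"

definition nonlinear_in_every_component :: "'n set \<Rightarrow> (('n \<Rightarrow> real) \<Rightarrow> real) \<Rightarrow> bool" where
  "nonlinear_in_every_component I g \<longleftrightarrow>
     (\<forall>a\<in>I. \<exists>v\<in>subvectors (I - {a}). \<not> (\<exists>\<alpha> \<beta>. \<forall>t. g (v(a := t)) = \<alpha> * t + \<beta>))"

definition smooth :: "(real \<Rightarrow> real) \<Rightarrow> bool" where
  "smooth h \<longleftrightarrow> (\<forall>m u. (deriv ^^ m) h differentiable at u)"

definition gradient :: "('v::real_inner \<Rightarrow> real) \<Rightarrow> 'v \<Rightarrow> 'v" where
  "gradient g x = (THE D. GDERIV g x :> D)"

text \<open>
  The score depends pointwise on \<open>p\<close>, whereas a Lebesgue density is determined only up to a null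
  set: it is meant to be applied to the (unique) continuous version of a density.
\<close>

definition score :: "('v::real_inner \<Rightarrow> real) \<Rightarrow> 'v \<Rightarrow> 'v" where
  "score p x = gradient (\<lambda>y. ln (p y)) x"

end

theory Submission
  imports Defs
begin

text \<open>
  The map \<open>y \<mapsto> (y\<^sub>i - f\<^sub>i (pa\<^sub>i y))\<^sub>i\<close> sends \<open>X\<close> to the noise vector. By acyclicity it is a
  composition of shears, so it is injective and preserves Lebesgue measure. Hence
  \<open>p y = (\<Prod>i. p\<^sup>\<epsilon> (y\<^sub>i - f\<^sub>i (pa\<^sub>i y)))\<close> almost everywhere, and everywhere because both sides are
  continuous. Near a point of positive density the logarithm turns the product into a sum, which
  is differentiated term by term.
\<close>

section \<open>Lebesgue measure under shears\<close>

lemma nn_integral_lborel_translate: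
  fixes c :: "'b::euclidean_space"
  assumes [measurable]: "h \<in> borel_measurable borel"
  shows "(\<integral>\<^sup>+y. h (y + c) \<partial>lborel) = (\<integral>\<^sup>+y. h y \<partial>lborel)"
proof -
  have "(\<integral>\<^sup>+y. h y \<partial>lborel) = (\<integral>\<^sup>+y. h y \<partial>distr lborel borel ((+) c))"
    by (simp add: lborel_distr_plus)
  also have "\<dots> = (\<integral>\<^sup>+y. h (c + y) \<partial>lborel)"
    by (subst nn_integral_distr) auto
  finally show ?thesis by (simp add: add.commute)
qed

text \<open>
  Averaging over an auxiliary translation \<open>t \<in> [0, 1]\<close> in direction \<open>e\<close> reduces the shear to
  translation invariance, without splitting off the coordinate \<open>e\<close> by Fubini.
\<close>

lemma nn_integral_shear:
  fixes g :: "'b::euclidean_space \<Rightarrow> real"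
  assumes h [measurable]: "h \<in> borel_measurable borel"
    and g [measurable]: "g \<in> borel_measurable borel"
    and inv: "\<And>y t. g (y + t *\<^sub>R e) = g y"
  shows "(\<integral>\<^sup>+y. h (y + g y *\<^sub>R e) \<partial>lborel) = (\<integral>\<^sup>+y. h y \<partial>lborel)"
proof -
  define k :: "real \<Rightarrow> ennreal" where "k = indicator {0..1}"
  have [measurable]: "k \<in> borel_measurable borel"
    by (simp add: k_def)
  have k1: "(\<integral>\<^sup>+t. k t \<partial>lborel) = 1"
    by (simp add: k_def)
  have "(\<integral>\<^sup>+y. h (y + g y *\<^sub>R e) \<partial>lborel) = (\<integral>\<^sup>+y. \<integral>\<^sup>+t. h (y + g y *\<^sub>R e) * k t \<partial>lborel \<partial>lborel)"
    by (simp add: nn_integral_cmult k1)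
  also have "\<dots> = (\<integral>\<^sup>+t. \<integral>\<^sup>+y. h (y + g y *\<^sub>R e) * k t \<partial>lborel \<partial>lborel)"
    by (rule lborel_pair.Fubini') measurable
  \<comment> \<open>For fixed \<open>t\<close> the variable \<open>y\<close> is moved by
    \<open>t *\<^sub>R e\<close>. By \<open>inv\<close> the value of \<open>g\<close> does not
    change, so the total displacement along \<open>e\<close> becomes \<open>t + g y\<close>.\<close>
  also have "\<dots> = (\<integral>\<^sup>+t. \<integral>\<^sup>+y. h (y + t *\<^sub>R e + g (y + t *\<^sub>R e) *\<^sub>R e) * k t \<partial>lborel \<partial>lborel)"
    by (intro nn_integral_cong nn_integral_lborel_translate [symmetric]) measurable
  also have "\<dots> = (\<integral>\<^sup>+y. \<integral>\<^sup>+t. h (y + (t + g y) *\<^sub>R e) * k t \<partial>lborel \<partial>lborel)"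
    by (subst lborel_pair.Fubini', measurable) (simp add: inv algebra_simps)
  \<comment> \<open>For fixed \<open>y\<close>, substituting \<open>t - g y\<close> for
    \<open>t\<close> moves \<open>g\<close> out of the argument of \<open>h\<close> and into the
    weight \<open>k\<close>.\<close>
  also have "\<dots> = (\<integral>\<^sup>+y. \<integral>\<^sup>+t. h (y + t *\<^sub>R e) * k (t - g y) \<partial>lborel \<partial>lborel)"
  proof (rule nn_integral_cong)
    fix y
    show "(\<integral>\<^sup>+t. h (y + (t + g y) *\<^sub>R e) * k t \<partial>lborel) = (\<integral>\<^sup>+t. h (y + t *\<^sub>R e) * k (t - g y) \<partial>lborel)"
      using nn_integral_lborel_translate [of "\<lambda>t. h (y + t *\<^sub>R e) * k (t - g y)" "g y"] by simp
  qed
  \<comment> \<open>Using \<open>inv\<close> once more, the translation in \<open>y\<close> can be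
    undone. All that remains of the shear is a shifted weight, whose integral over \<open>t\<close>
    is still 1.\<close>
  also have "\<dots> = (\<integral>\<^sup>+t. \<integral>\<^sup>+y. h (y + t *\<^sub>R e) * k (t - g (y + t *\<^sub>R e)) \<partial>lborel \<partial>lborel)"
    by (subst lborel_pair.Fubini', measurable) (simp add: inv)
  also have "\<dots> = (\<integral>\<^sup>+t. \<integral>\<^sup>+y. h y * k (t - g y) \<partial>lborel \<partial>lborel)"
    by (intro nn_integral_cong nn_integral_lborel_translate) measurable
  also have "\<dots> = (\<integral>\<^sup>+y. \<integral>\<^sup>+t. h y * k (t - g y) \<partial>lborel \<partial>lborel)"
    by (rule lborel_pair.Fubini') measurable
  also have "\<dots> = (\<integral>\<^sup>+y. h y \<partial>lborel)"
    using nn_integral_lborel_translate [of k "- g y" for y] by (simp add: nn_integral_cmult k1)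
  finally show ?thesis .
qed

lemma distr_lborel_shear:
  fixes g :: "'b::euclidean_space \<Rightarrow> real"
  assumes g [measurable]: "g \<in> borel_measurable borel"
    and inv: "\<And>y t. g (y + t *\<^sub>R e) = g y"
  shows "distr lborel borel (\<lambda>y. y + g y *\<^sub>R e) = lborel"
proof (rule measure_eqI)
  fix A assume "A \<in> sets (distr lborel borel (\<lambda>y. y + g y *\<^sub>R e))"
  then have [measurable]: "A \<in> sets borel" by simp
  have "emeasure (distr lborel borel (\<lambda>y. y + g y *\<^sub>R e)) A
      = (\<integral>\<^sup>+y. indicator A (y + g y *\<^sub>R e) \<partial>lborel)"
    by (subst nn_integral_indicator [symmetric], simp, subst nn_integral_distr) auto
  also have "\<dots> = emeasure lborel A"
    by (subst nn_integral_shear [OF _ g inv]) auto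
  finally show "emeasure (distr lborel borel (\<lambda>y. y + g y *\<^sub>R e)) A = emeasure lborel A" .
qed simp

section \<open>Product structure of Lebesgue measure and joint densities\<close>

lemma measurable_vec_lambda [measurable]:
  "vec_lambda \<in> measurable (PiM UNIV (\<lambda>i::'n::finite. borel)) (borel :: (real ^ 'n) measure)"
  by (subst borel_measurable_euclidean_space) (auto simp: Basis_vec_def inner_axis)

lemma measurable_vec_lambda_lborel [measurable]:
  "vec_lambda \<in> measurable (PiM UNIV (\<lambda>i::'n::finite. lborel)) (borel :: (real ^ 'n) measure)"
  using measurable_vec_lambda by (simp cong: measurable_cong_sets sets_PiM_cong)

lemma borel_measurable_vec_nth [measurable]:
  "(\<lambda>y :: real ^ 'n. y $ i) \<in> borel_measurable borel"
  by (intro borel_measurable_continuous_onI continuous_intros)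

text \<open>\<open>lborel\<close> is determined by the volumes of boxes, and the preimage of a box
  under \<open>vec_lambda\<close> is a product of intervals. This bridge makes the product-measure
  theory on functions available on \<open>real ^ 'n\<close>.\<close>

lemma distr_PiM_lborel:
  "distr (PiM UNIV (\<lambda>i::'n::finite. lborel)) borel vec_lambda = (lborel :: (real ^ 'n) measure)"
proof (rule lborel_eqI [symmetric])
  interpret product_sigma_finite "\<lambda>i::'n. lborel :: real measure" ..
  fix l u :: "real ^ 'n"
  assume lu: "\<And>b. b \<in> Basis \<Longrightarrow> l \<bullet> b \<le> u \<bullet> b"
  have le: "l $ i \<le> u $ i" for i
    using lu [of "axis i 1"] by (simp add: inner_axis)
  have "vec_lambda -` box l u = (Pi\<^sub>E UNIV (\<lambda>i. {l $ i<..<u $ i}))"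
    by (auto simp: box_def Basis_vec_def inner_axis PiE_UNIV_domain)
  then have "emeasure (distr (PiM UNIV (\<lambda>i::'n. lborel)) borel vec_lambda) (box l u)
      = emeasure (PiM UNIV (\<lambda>i::'n. lborel)) (Pi\<^sub>E UNIV (\<lambda>i. {l $ i<..<u $ i}))"
    by (subst emeasure_distr) (auto simp: space_PiM)
  also have "\<dots> = (\<Prod>i\<in>UNIV. ennreal (u $ i - l $ i))"
    by (subst emeasure_PiM) (auto simp: le)
  also have "\<dots> = ennreal (\<Prod>b\<in>Basis. (u - l) \<bullet> b)"
    by (simp add: prod_ennreal le Basis_vec_def prod.UNION_disjoint inj_on_def axis_eq_axis
        prod.reindex inner_axis flip: image_UN)
  finally show "emeasure (distr (PiM UNIV (\<lambda>i::'n. lborel)) borel vec_lambda) (box l u)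
      = (\<Prod>b\<in>Basis. (u - l) \<bullet> b)" .
qed simp

lemma nn_integral_lborel_prod:
  fixes h :: "'n::finite \<Rightarrow> real \<Rightarrow> ennreal"
  assumes [measurable]: "\<And>i. h i \<in> borel_measurable borel"
  shows "(\<integral>\<^sup>+y. (\<Prod>i\<in>UNIV. h i (y $ i)) \<partial>lborel) = (\<Prod>i\<in>UNIV. \<integral>\<^sup>+t. h i t \<partial>lborel)"
proof -
  interpret product_sigma_finite "\<lambda>i::'n. lborel :: real measure" ..
  have "(\<integral>\<^sup>+y. (\<Prod>i\<in>UNIV. h i (y $ i)) \<partial>lborel)
      = (\<integral>\<^sup>+y. (\<Prod>i\<in>UNIV. h i (y i)) \<partial>PiM UNIV (\<lambda>i::'n. lborel))"
    by (subst distr_PiM_lborel [symmetric], subst nn_integral_distr) auto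
  also have "\<dots> = (\<Prod>i\<in>UNIV. \<integral>\<^sup>+t. h i t \<partial>lborel)"
    by (rule product_nn_integral_prod) auto
  finally show ?thesis .
qed

text \<open>Both laws, read on the function space, equal the product of the marginal laws: one by
  independence, the other because the product density factorises.\<close>

lemma (in prob_space) distr_indep_vars_density:
  fixes Y :: "'n::finite \<Rightarrow> 'a \<Rightarrow> real"
  assumes indep: "indep_vars (\<lambda>_. borel) Y UNIV"
    and dens: "\<And>i. distributed M lborel (Y i) (\<lambda>t. ennreal (q i t))"
    and q0: "\<And>i t. 0 \<le> q i t"
  shows "distr M borel (\<lambda>\<omega>. \<chi> i. Y i \<omega>) = density lborel (\<lambda>u. ennreal (\<Prod>i\<in>UNIV. q i (u $ i)))"
proof -
  have [measurable]: "Y i \<in> borel_measurable M" for i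
    using dens [of i, THEN distributed_measurable] by simp
  have [measurable]: "q i \<in> borel_measurable borel" for i
    using distributed_real_measurable [OF _ dens] q0 by simp
  have Y: "distr M borel (Y i) = density lborel (q i)" for i
    using dens [of i] by (simp add: distributed_def cong: distr_cong)
  \<comment> \<open>Each factor is sigma-finite because it is the law of \<open>Y i\<close>, a
    probability measure.\<close>
  interpret D: product_sigma_finite "\<lambda>i. density lborel (\<lambda>t. ennreal (q i t))"
  proof (rule product_sigma_finite.intro)
    fix i
    interpret Y: prob_space "distr M borel (Y i)" by (rule prob_space_distr) simp
    show "sigma_finite_measure (density lborel (\<lambda>t. ennreal (q i t)))"
      unfolding Y [symmetric] by (rule Y.sigma_finite_measure_axioms)
  qed
  let ?q = "\<lambda>u :: real ^ 'n. ennreal (\<Prod>i\<in>UNIV. q i (u $ i))"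
  have V [measurable]: "vec_nth \<in> measurable (borel :: (real ^ 'n) measure) (PiM UNIV (\<lambda>i::'n. borel))"
    by (rule measurable_PiM_single') auto
  \<comment> \<open>It suffices to compare the measures on rectangles, where the integral splits
    into one factor per coordinate.\<close>
  have "distr (density lborel ?q) (PiM UNIV (\<lambda>i. borel)) vec_nth = PiM UNIV (\<lambda>i. density lborel (q i))"
  proof (rule D.PiM_eqI)
    fix A assume "\<And>i::'n. i \<in> UNIV \<Longrightarrow> A i \<in> sets (density lborel (q i))"
    then have [measurable]: "A i \<in> sets borel" for i by auto
    have [measurable]: "Pi\<^sub>E UNIV A \<in> sets (PiM UNIV (\<lambda>i. borel))"
      by (rule sets_PiM_I_finite) auto
    have "emeasure (distr (density lborel ?q) (PiM UNIV (\<lambda>i. borel)) vec_nth) (Pi\<^sub>E UNIV A)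
        = (\<integral>\<^sup>+u. ?q u * indicator (vec_nth -` Pi\<^sub>E UNIV A) u \<partial>lborel)"
      using measurable_sets_borel
      by (subst emeasure_distr, measurable, subst emeasure_density)
        (auto intro: measurable_sets [OF V, simplified])
    also have "\<dots> = (\<integral>\<^sup>+u. (\<Prod>i\<in>UNIV. ennreal (q i (u $ i)) * indicator (A i) (u $ i)) \<partial>lborel)"
      by (intro nn_integral_cong)
        (auto simp: prod.distrib prod_ennreal q0 PiE_UNIV_domain indicator_def Pi_iff prod_zero_iff split: if_splits)
    also have "\<dots> = (\<Prod>i\<in>UNIV. emeasure (density lborel (q i)) (A i))"
      by (subst nn_integral_lborel_prod) (auto simp: emeasure_density)
    finally show "emeasure (distr (density lborel ?q) (PiM UNIV (\<lambda>i. borel)) vec_nth) (Pi\<^sub>E UNIV A)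
        = (\<Prod>i\<in>UNIV. emeasure (density lborel (q i)) (A i))" .
  qed (auto cong: sets_PiM_cong)
  also have "\<dots> = distr M (PiM UNIV (\<lambda>i. borel)) (\<lambda>\<omega>. \<lambda>i\<in>UNIV. Y i \<omega>)"
    using indep by (subst (asm) indep_vars_iff_distr_eq_PiM) (simp_all add: Y)
  finally have eq: "distr (density lborel ?q) (PiM UNIV (\<lambda>i. borel)) vec_nth
    = distr M (PiM UNIV (\<lambda>i. borel)) (\<lambda>\<omega>. \<lambda>i\<in>UNIV. Y i \<omega>)" .
  \<comment> \<open>\<open>vec_lambda\<close> undoes \<open>vec_nth\<close>, so the equality of laws
    is carried back to \<open>real ^ 'n\<close>.\<close>
  have "distr M borel (\<lambda>\<omega>. \<chi> i. Y i \<omega>)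
      = distr (distr M (PiM UNIV (\<lambda>i. borel)) (\<lambda>\<omega>. \<lambda>i\<in>UNIV. Y i \<omega>)) borel vec_lambda"
    by (subst distr_distr) (auto simp: comp_def restrict_def intro!: measurable_PiM_single')
  also have "\<dots> = distr (density lborel ?q) borel (\<lambda>u. u)"
    unfolding eq [symmetric] by (subst distr_distr) (auto simp: comp_def)
  also have "\<dots> = density lborel ?q"
    by (rule distr_id2) simp
  finally show ?thesis .
qed


section \<open>The map from observations to noise\<close>

text \<open>
  The full map \<open>noise_on E f UNIV\<close> recovers the noise from \<open>X\<close>; the restriction to \<open>S\<close> is there
  for an induction that splits off a node of \<open>S\<close> without parents in \<open>S\<close>, which contributes
  one shear.
\<close>

definition noise_on :: "('n \<times> 'n) set \<Rightarrow> ('n \<Rightarrow> ('n \<Rightarrow> real) \<Rightarrow> real) \<Rightarrow> 'n set \<Rightarrow> real ^ 'n \<Rightarrow> real ^ 'n" where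
  "noise_on E f S y = (\<chi> i. y $ i - (if i \<in> S then f i (pa E i y) else 0))"

text \<open>Injectivity is carried through the induction as a measurable left inverse
  \<open>G\<close>, so that later \<open>X\<close> can be written as a measurable function of the
  noise vector.\<close>

lemma noise_on_measure_preserving:
  fixes E :: "('n::finite \<times> 'n) set"
  assumes E: "acyclic E"
    and meas [measurable]: "\<And>i. (\<lambda>y. f i (pa E i y)) \<in> borel_measurable borel"
  shows "noise_on E f S \<in> borel_measurable borel \<and> distr lborel borel (noise_on E f S) = lborel \<and>
    (\<exists>G\<in>borel_measurable borel. \<forall>y. G (noise_on E f S y) = y)"
  using finite [of S]
proof (induction S rule: finite_psubset_induct)
  case (psubset S)
  show ?case
  proof (cases "S = {}")
    case True
    then have "noise_on E f S = (\<lambda>y. y)"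
      by (simp add: noise_on_def fun_eq_iff)
    then show ?thesis
      by (auto simp: distr_id2)
  next
    case False
    have "wf E"
      using E by (simp add: finite_acyclic_wf)
    with False obtain a where a: "a \<in> S" "\<And>k. (k, a) \<in> E \<Longrightarrow> k \<notin> S"
      by (metis wfE_min ex_in_conv)
    define T where "T = S - {a}"
    have "T \<subset> S"
      using a by (auto simp: T_def)
    from psubset.IH [OF this] obtain G
      where T [measurable]: "noise_on E f T \<in> borel_measurable borel"
        and distr_T: "distr lborel borel (noise_on E f T) = lborel"
        and G [measurable]: "G \<in> borel_measurable borel"
        and GT: "\<And>y. G (noise_on E f T y) = y"
      by blast
    define g where "g y = - f a (pa E a y)" for y
    have [measurable]: "g \<in> borel_measurable borel"
      by (simp add: g_def [abs_def])
    define sh where "sh y = y + g y *\<^sub>R axis a 1" for y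
    define sh' where "sh' y = y - g y *\<^sub>R axis a 1" for y
    have [measurable]: "sh \<in> borel_measurable borel" "sh' \<in> borel_measurable borel"
      by (simp_all add: sh_def [abs_def] sh'_def [abs_def])
    \<comment> \<open>\<open>g\<close> reads only the parents of \<open>a\<close>, all of which lie
      outside \<open>S\<close>. Hence it ignores both the shear direction, as \<open>a\<close>
      itself is in \<open>S\<close>, and the changes made by \<open>noise_on E f T\<close>, which
      affect only coordinates in \<open>T\<close>.\<close>
    have cong: "g y = g z" if "\<And>k. k \<notin> S \<Longrightarrow> y $ k = z $ k" for y z
    proof -
      have "pa E a y = pa E a z"
        using a that by (auto simp: pa_def parents_def restrict_def fun_eq_iff)
      then show ?thesis by (simp add: g_def)
    qed
    have inv: "g (y + t *\<^sub>R axis a 1) = g y" for y t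
      using a by (intro cong) (auto simp: axis_def)
    \<comment> \<open>Consequently the shear applied after \<open>noise_on E f T\<close> still
      subtracts \<open>f a\<close> evaluated at the original \<open>y\<close>.\<close>
    have "g (noise_on E f T y) = g y" for y
      by (intro cong) (auto simp: noise_on_def T_def)
    then have "sh (noise_on E f T y) = noise_on E f S y" for y
      using a by (auto simp: vec_eq_iff sh_def noise_on_def T_def g_def axis_def)
    then have S: "noise_on E f S = sh \<circ> noise_on E f T"
      by (simp add: fun_eq_iff)
    have sh': "sh' (sh y) = y" for y
      by (simp add: sh_def sh'_def inv)
    have "distr lborel borel (noise_on E f S) = distr (distr lborel borel (noise_on E f T)) borel sh"
      unfolding S by (subst distr_distr) auto
    also have "\<dots> = lborel"
      unfolding distr_T sh_def by (intro distr_lborel_shear inv) measurable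
    finally have "distr lborel borel (noise_on E f S) = lborel" .
    moreover have "noise_on E f S \<in> borel_measurable borel"
      unfolding S by (rule measurable_comp [OF T]) measurable
    moreover have "G \<circ> sh' \<in> borel_measurable borel" "\<forall>y. (G \<circ> sh') (noise_on E f S y) = y"
      by (auto simp: S sh' GT)
    ultimately show ?thesis
      by blast
  qed
qed

section \<open>Differentiability from continuous partial derivatives; gradients\<close>

text \<open>Induction on the set \<open>K\<close> of coordinates that may move: \<open>P K\<close>
  projects the increment onto these coordinates, and each step adds one direction with a continuous
  partial derivative.\<close>

lemma has_derivative_vec_partials:
  fixes g :: "real ^ 'n \<Rightarrow> real"
  assumes part: "\<And>k y. ((\<lambda>t. g (y + t *\<^sub>R axis k 1)) has_field_derivative D k y) (at 0)"
    and cont: "\<And>k. continuous_on UNIV (D k)"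
  shows "(g has_derivative (\<lambda>h. \<Sum>k\<in>UNIV. D k x * h $ k)) (at x)"
proof -
  define P :: "'n set \<Rightarrow> real ^ 'n \<Rightarrow> real ^ 'n" where "P K h = (\<chi> k. if k \<in> K then h $ k else 0)" for K h
  have P0 [simp]: "P K 0 = 0" for K
    by (simp add: P_def vec_eq_iff)
  have contP: "continuous_on UNIV (P K)" for K
  proof -
    have "continuous_on UNIV (\<lambda>h :: real ^ 'n. if k \<in> K then h $ k else 0)" for k
      by (cases "k \<in> K") (auto intro!: continuous_intros)
    then show ?thesis
      unfolding P_def by (rule continuous_on_vec_lambda)
  qed
  have "((\<lambda>h. g (x + P K h)) has_derivative (\<lambda>h. \<Sum>k\<in>K. D k x * h $ k)) (at 0)" if "finite K" for K
    using that
  proof (induction K rule: finite_induct)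
    case empty
    have "P {} h = 0" for h
      by (simp add: P_def vec_eq_iff)
    then show ?case by simp
  next
    case (insert a K)
    \<comment> \<open>The new coordinate becomes a separate real variable \<open>t\<close>.
      Differentiability in \<open>s\<close> at 0 along \<open>t = 0\<close> is the induction
      hypothesis; in \<open>t\<close> the derivative exists everywhere and is jointly continuous.
      Together these give the total derivative in \<open>(s, t)\<close>.\<close>
    let ?z = "\<lambda>s t. x + P K s + t *\<^sub>R axis a 1"
    have line: "((\<lambda>t. g (?z s t)) has_derivative blinfun_mult_right (D a (?z s t))) (at t within UNIV)" for s t
      using part [of "?z s t" a] DERIV_shift [of "\<lambda>t. g (?z s t)" "D a (?z s t)" 0 t]
      by (simp add: has_field_derivative_def algebra_simps scaleR_add_left)
    have "continuous_on UNIV (\<lambda>(s, t). blinfun_mult_right (D a (?z s t)))"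
      unfolding split_def
      by (intro bounded_linear.continuous_on [OF bounded_linear_blinfun_mult_right]
          continuous_on_compose2 [OF cont] continuous_on_compose2 [OF contP] continuous_intros) auto
    then have "((\<lambda>(s, t). g (?z s t)) has_derivative
        (\<lambda>(s, t). (\<Sum>k\<in>K. D k x * s $ k) + blinfun_mult_right (D a (?z 0 0)) t)) (at (0, 0) within UNIV \<times> UNIV)"
      using insert.IH line
      by (intro has_derivative_partialsI) (auto simp: continuous_on_eq_continuous_within)
    then have g: "((\<lambda>(s, t). g (?z s t)) has_derivative
        (\<lambda>(s, t). (\<Sum>k\<in>K. D k x * s $ k) + D a x * t)) (at (0, 0 $ a))"
      by simp
    \<comment> \<open>Setting \<open>t = h $ a\<close> merges the two variables again, giving the
      increment \<open>P (insert a K) h\<close>.\<close>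
    have pair: "((\<lambda>h. (h, h $ a)) has_derivative (\<lambda>h. (h, h $ a))) (at 0)"
      by (intro has_derivative_Pair has_derivative_ident bounded_linear_imp_has_derivative bounded_linear_vec_nth)
    have "((\<lambda>h. g (?z h (h $ a))) has_derivative
        (\<lambda>h. (\<Sum>k\<in>K. D k x * h $ k) + D a x * h $ a)) (at 0)"
      using has_derivative_compose [OF pair g] by simp
    moreover have "P (insert a K) h = P K h + h $ a *\<^sub>R axis a 1" for h
      using insert.hyps by (auto simp: P_def vec_eq_iff axis_def)
    ultimately show ?case
      using insert.hyps by (simp add: ac_simps)
  qed
  from this [of UNIV] have "((\<lambda>h. g (x + h)) has_derivative (\<lambda>h. \<Sum>k\<in>UNIV. D k x * h $ k)) (at 0)"
    by (simp add: P_def)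
  then have g: "((\<lambda>h. g (x + h)) has_derivative (\<lambda>h. \<Sum>k\<in>UNIV. D k x * h $ k)) (at (x - x))"
    by simp
  have "((\<lambda>y. y - x) has_derivative (\<lambda>h. h)) (at x)"
    by (auto intro!: derivative_eq_intros)
  from has_derivative_compose [OF this g] show ?thesis
    by simp
qed

lemma continuous_on_subvector:
  assumes "continuous_on (subvectors I) g"
  shows "continuous_on UNIV (\<lambda>y :: real ^ 'n. g (restrict (\<lambda>k. y $ k) I))"
proof (rule continuous_on_compose2 [OF assms])
  show "continuous_on UNIV (\<lambda>y :: real ^ 'n. restrict (\<lambda>k. y $ k) I)"
  proof (rule continuous_on_coordinatewise_then_product)
    fix i
    show "continuous_on UNIV (\<lambda>y :: real ^ 'n. restrict (\<lambda>k. y $ k) I i)"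
      by (cases "i \<in> I") (auto intro!: continuous_intros)
  qed
qed auto

lemma continuously_differentiable_imp_continuous_on:
  "continuously_differentiable m I g \<Longrightarrow> continuous_on (subvectors I) g"
  by (cases m) auto

text \<open>The functions \<open>f i\<close> live on extensional functions, whose type has no norm.
  Pulling them back to \<open>real ^ 'n\<close> by restriction gives access to total
  derivatives.\<close>

lemma has_derivative_subvector:
  fixes x :: "real ^ 'n"
  assumes "continuously_differentiable (Suc m) I g"
  shows "((\<lambda>y. g (restrict (\<lambda>k. y $ k) I)) has_derivative
    (\<lambda>h. \<Sum>k\<in>I. partial_deriv k g (restrict (\<lambda>k. x $ k) I) * h $ k)) (at x)"
proof -
  let ?r = "\<lambda>y :: real ^ 'n. restrict (\<lambda>k. y $ k) I"
  \<comment> \<open>Moving a coordinate outside \<open>I\<close> leaves the restriction unchanged,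
    hence the value 0 there.\<close>
  define D where "D k y = (if k \<in> I then partial_deriv k g (?r y) else 0)" for k y
  have "((\<lambda>y. g (?r y)) has_derivative (\<lambda>h. \<Sum>k\<in>UNIV. D k x * h $ k)) (at x)"
  proof (rule has_derivative_vec_partials)
    fix k and y :: "real ^ 'n"
    show "((\<lambda>t. g (?r (y + t *\<^sub>R axis k 1))) has_field_derivative D k y) (at 0)"
    proof (cases "k \<in> I")
      case True
      have "?r y \<in> subvectors I"
        by simp
      then have "(\<lambda>t. g ((?r y)(k := t))) differentiable at (?r y k)"
        using assms True unfolding continuously_differentiable.simps by blast
      then have "((\<lambda>t. g ((?r y)(k := t))) has_field_derivative D k y) (at (y $ k))"
        using True by (simp add: D_def partial_deriv_def DERIV_deriv_iff_real_differentiable)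
      then have "((\<lambda>t. g ((?r y)(k := y $ k + t))) has_field_derivative D k y) (at 0)"
        using DERIV_shift [of "\<lambda>t. g ((?r y)(k := t))" "D k y" 0 "y $ k"] by (simp add: add.commute)
      moreover have "?r (y + t *\<^sub>R axis k 1) = (?r y)(k := y $ k + t)" for t
        using True by (auto simp: axis_def)
      ultimately show ?thesis by simp
    next
      case False
      then have "?r (y + t *\<^sub>R axis k 1) = ?r y" for t
        by (auto simp: axis_def restrict_def)
      with False show ?thesis by (simp add: D_def)
    qed
    show "continuous_on UNIV (D k)"
      using assms unfolding D_def
      by (cases "k \<in> I") (auto intro!: continuous_on_subvector continuously_differentiable_imp_continuous_on)
  qed
  then show ?thesis
    by (simp add: D_def if_distrib [of "\<lambda>c. c * _"] sum.If_cases cong: if_cong)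
qed

text \<open>The definite description in \<open>gradient\<close> is resolved by uniqueness of the
  derivative: the vector of values of \<open>L\<close> on the axes represents \<open>L\<close>, and
  no other vector does.\<close>

lemma gradient_nth:
  fixes g :: "real ^ 'n \<Rightarrow> real"
  assumes g: "(g has_derivative L) (at x)"
  shows "gradient g x $ j = L (axis j 1)"
proof -
  interpret L: bounded_linear L
    using g by (rule has_derivative_bounded_linear)
  define D where "D = (\<chi> k. L (axis k 1))"
  have "L = (\<lambda>h. h \<bullet> D)"
  proof
    fix h
    have "L h = L (\<Sum>k\<in>UNIV. h $ k *\<^sub>R axis k 1)"
      by (simp add: basis_expansion flip: scalar_mult_eq_scaleR)
    then show "L h = h \<bullet> D"
      by (simp add: L.sum L.scaleR D_def inner_vec_def)
  qed
  then have D: "GDERIV g x :> D"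
    using g by (simp add: gderiv_def)
  have "D' = D" if "GDERIV g x :> D'" for D'
  proof -
    have "(\<lambda>h. h \<bullet> D') = (\<lambda>h. h \<bullet> D)"
      using that D unfolding gderiv_def by (rule has_derivative_unique)
    then show ?thesis
      by (metis inner_commute vector_eq_rdot)
  qed
  with D have "gradient g x = D"
    unfolding gradient_def by (rule the_equality)
  then show ?thesis by (simp add: D_def)
qed

section \<open>The density of \<open>X\<close> and its score\<close>

text \<open>Change of variables at the level of measures: almost surely \<open>X\<close> is
  \<open>G\<close> of the noise vector, so its law is the image under \<open>G\<close> of the joint
  noise law.\<close>

lemma additive_noise_density:
  fixes X :: "'a \<Rightarrow> real ^ 'n" and E :: "('n \<times> 'n) set"
  assumes "prob_space M" "acyclic E"
    and f: "\<And>i. continuous_on (subvectors (parents E i)) (f i)"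
    and indep: "prob_space.indep_vars M (\<lambda>_. borel) \<epsilon> UNIV"
    and dens: "\<And>i. distributed M lborel (\<epsilon> i) (\<lambda>u. ennreal (q i u))"
    and q0: "\<And>i u. q i u \<ge> 0"
    and q: "\<And>i. continuous_on UNIV (q i)"
    and X: "\<And>i. AE \<omega> in M. X \<omega> $ i = f i (pa E i (X \<omega>)) + \<epsilon> i \<omega>"
    and p: "distributed M lborel X (\<lambda>y. ennreal (p y))" "\<And>y. p y \<ge> 0" "continuous_on UNIV p"
  shows "p y = (\<Prod>i\<in>UNIV. q i (y $ i - f i (pa E i y)))"
proof -
  interpret prob_space M by fact
  have cf: "continuous_on UNIV (\<lambda>y. f i (pa E i y))" for i
    unfolding pa_def by (intro continuous_on_subvector f)
  have [measurable]: "(\<lambda>y. f i (pa E i y)) \<in> borel_measurable borel" for i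
    by (intro borel_measurable_continuous_onI cf)
  have [measurable]: "q i \<in> borel_measurable borel" for i
    by (intro borel_measurable_continuous_onI q)
  have [measurable]: "\<epsilon> i \<in> borel_measurable M" for i
    using dens [of i, THEN distributed_measurable] by simp
  have [measurable]: "X \<in> borel_measurable M"
    using p(1) [THEN distributed_measurable] by simp
  let ?F = "noise_on E f UNIV" and ?e = "\<lambda>\<omega>. \<chi> i. \<epsilon> i \<omega>"
  let ?q = "\<lambda>u :: real ^ 'n. \<Prod>i\<in>UNIV. q i (u $ i)"
  have [measurable]: "?e \<in> borel_measurable M"
    by (subst borel_measurable_euclidean_space) (auto simp: Basis_vec_def inner_axis)
  obtain G where F [measurable]: "?F \<in> borel_measurable borel"
    and distr_F: "distr lborel borel ?F = lborel"
    and G [measurable]: "G \<in> borel_measurable borel"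
    and GF: "\<And>y. G (?F y) = y"
    using noise_on_measure_preserving [of E f UNIV] \<open>acyclic E\<close> by auto
  have "AE \<omega> in M. \<forall>i. X \<omega> $ i = f i (pa E i (X \<omega>)) + \<epsilon> i \<omega>"
    using X by (simp add: AE_all_countable)
  then have "AE \<omega> in M. X \<omega> = G (?e \<omega>)"
  proof eventually_elim
    case (elim \<omega>)
    then have "?F (X \<omega>) = ?e \<omega>"
      by (simp add: noise_on_def vec_eq_iff)
    then show ?case
      using GF [of "X \<omega>"] by simp
  qed
  then have "distr M borel X = distr M borel (\<lambda>\<omega>. G (?e \<omega>))"
    by (intro distr_cong_AE) auto
  also have "\<dots> = distr (distr M borel ?e) borel G"
    by (subst distr_distr) (auto simp: comp_def)
  \<comment> \<open>Writing \<open>lborel\<close> as its own image under \<open>?F\<close> lets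
    \<open>density_distr\<close> pull the noise density back along \<open>?F\<close>, without a
    Jacobian factor; afterwards \<open>G\<close> cancels \<open>?F\<close>.\<close>
  also have "distr M borel ?e = density (distr lborel borel ?F) ?q"
    unfolding distr_F by (intro distr_indep_vars_density indep dens q0)
  also have "\<dots> = distr (density lborel (\<lambda>y. ?q (?F y))) borel ?F"
    by (intro density_distr) auto
  also have "distr \<dots> borel G = density lborel (\<lambda>y. ?q (?F y))"
    by (subst distr_distr) (auto simp: comp_def GF intro!: distr_id2)
  finally have "distr M lborel X = density lborel (\<lambda>y. ?q (?F y))"
    by (simp cong: distr_cong)
  then have "distributed M lborel X (\<lambda>y. ?q (?F y))"
    by (simp add: distributed_def)
  from distributed_unique [OF p(1) this]
  have "AE y in lborel. y \<in> {y. p y = ?q (?F y)}"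
    by eventually_elim (simp add: p prod_nonneg q0)
  \<comment> \<open>A closed set of full Lebesgue measure is the whole space, since its complement
    is open and null.\<close>
  then have "AE y in lebesgue. y \<in> {y. p y = ?q (?F y)}"
    by (rule AE_completion)
  moreover have "closed {y. p y = ?q (?F y)}"
    unfolding noise_on_def
    by (intro closed_Collect_eq p continuous_on_prod continuous_on_compose2 [OF q])
      (auto intro!: continuous_intros cf)
  ultimately have "y \<in> {y. p y = ?q (?F y)}"
    by (rule mem_closed_if_AE_lebesgue [rotated])
  then show ?thesis
    by (simp add: noise_on_def)
qed

theorem lemma2:
  fixes M :: "'a measure"
    and E :: "('n::finite \<times> 'n) set"
    and f :: "'n \<Rightarrow> ('n \<Rightarrow> real) \<Rightarrow> real"
    and \<epsilon> :: "'n \<Rightarrow> 'a \<Rightarrow> real"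
    and p\<epsilon> :: "real \<Rightarrow> real"
    and X :: "'a \<Rightarrow> real ^ 'n"
    and p :: "real ^ 'n \<Rightarrow> real"
    and x :: "real ^ 'n"
    and j :: 'n
  assumes "prob_space M"
    and "acyclic E"
    and "\<And>i. continuously_differentiable 2 (parents E i) (f i)"
    and "\<And>i. nonlinear_in_every_component (parents E i) (f i)"
    and "prob_space.indep_vars M (\<lambda>_. borel) \<epsilon> UNIV"
    and "\<And>i. distributed M lborel (\<epsilon> i) p\<epsilon>"
    and "\<And>u. p\<epsilon> u \<ge> 0"
    and "smooth p\<epsilon>"
    and "\<And>i. AE \<omega> in M. X \<omega> $ i = f i (pa E i (X \<omega>)) + \<epsilon> i \<omega>"
    and "distributed M lborel X p"
    and "\<And>y. p y \<ge> 0"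
    and "continuous_on UNIV p"
    and "p x > 0"
  shows "(\<lambda>y. ln (p y)) differentiable at x \<and>
    score p x $ j =
      deriv (\<lambda>u. ln (p\<epsilon> u)) (x $ j - f j (pa E j x)) -
      (\<Sum>i\<in>children E j. partial_deriv j (f i) (pa E i x) *
         deriv (\<lambda>u. ln (p\<epsilon> u)) (x $ i - f i (pa E i x)))"
proof -
  have f: "continuously_differentiable (Suc 1) (parents E i) (f i)" for i
    using assms(3) [of i] by (simp only: numeral_2_eq_2 One_nat_def)
  have diff: "p\<epsilon> differentiable at u" for u
    using \<open>smooth p\<epsilon>\<close> unfolding smooth_def by (metis funpow_0)
  have p_eq: "p y = (\<Prod>i\<in>UNIV. p\<epsilon> (y $ i - f i (pa E i y)))" for y
  proof (rule additive_noise_density)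
    show "continuous_on UNIV p\<epsilon>"
      using diff by (intro continuous_at_imp_continuous_on) (auto intro: differentiable_imp_continuous_within)
    show "continuous_on (subvectors (parents E i)) (f i)" for i
      using f by (rule continuously_differentiable_imp_continuous_on)
  qed (use assms in auto)
  let ?u = "\<lambda>i y. y $ i - f i (pa E i y)"
  let ?l = "\<lambda>u. ln (p\<epsilon> u)"
  \<comment> \<open>A single zero factor would make the product vanish. Positivity of every factor
    is what the derivative of \<open>ln\<close> and the splitting of \<open>ln\<close> over the
    product require.\<close>
  have factor_pos: "p\<epsilon> (?u i y) > 0" if "p y > 0" for i y
  proof -
    have "p\<epsilon> (?u i y) \<noteq> 0"
      using that unfolding p_eq [of y] by (metis UNIV_I finite less_irrefl prod_zero)
    with assms(7) show ?thesis
      by (simp add: less_le)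
  qed
  have u: "(?u i has_derivative
      (\<lambda>h. h $ i - (\<Sum>k\<in>parents E i. partial_deriv k (f i) (pa E i x) * h $ k))) (at x)" for i
    unfolding pa_def using has_derivative_subvector [OF f]
    by (auto intro!: derivative_intros bounded_linear_imp_has_derivative bounded_linear_vec_nth)
  have l: "(?l has_field_derivative deriv ?l (?u i x)) (at (?u i x))" for i
  proof -
    obtain d where "(p\<epsilon> has_field_derivative d) (at (?u i x))"
      using diff [of "?u i x"] by (auto simp: real_differentiable_def)
    then have "(?l has_field_derivative d / p\<epsilon> (?u i x)) (at (?u i x))"
      using factor_pos [OF \<open>p x > 0\<close>, of i] by (auto intro!: derivative_eq_intros)
    then show ?thesis
      using DERIV_imp_deriv by metis
  qed
  define L where "L h = (\<Sum>i\<in>UNIV. deriv ?l (?u i x) *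
    (h $ i - (\<Sum>k\<in>parents E i. partial_deriv k (f i) (pa E i x) * h $ k)))" for h
  have "((\<lambda>y. \<Sum>i\<in>UNIV. ?l (?u i y)) has_derivative L) (at x)"
    unfolding L_def
    by (intro has_derivative_sum has_derivative_compose [OF u l [unfolded has_field_derivative_def]])
  \<comment> \<open>The logarithm splits into a sum only where \<open>p\<close> is positive; by
    continuity this is an open set around \<open>x\<close>, which is enough for the derivative at
    \<open>x\<close>.\<close>
  moreover have "open {y. p y > 0}"
    by (intro open_Collect_less assms continuous_intros)
  moreover have "(\<Sum>i\<in>UNIV. ?l (?u i y)) = ln (p y)" if "y \<in> {y. p y > 0}" for y
    using factor_pos [of y] that unfolding p_eq [of y, symmetric]
    by (subst p_eq) (simp add: ln_prod less_imp_neq [THEN not_sym])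
  ultimately have deriv: "((\<lambda>y. ln (p y)) has_derivative L) (at x)"
    using \<open>p x > 0\<close> by (elim has_derivative_transform_within_open) auto
  have score: "score p x $ j = L (axis j 1)"
    unfolding score_def by (rule gradient_nth [OF deriv])
  \<comment> \<open>In direction \<open>axis j 1\<close> the parent sum of node \<open>i\<close>
    keeps only the term \<open>k = j\<close>, present exactly when \<open>i\<close> is a child of
    \<open>j\<close>, while \<open>h $ i\<close> survives only for \<open>i = j\<close>.\<close>
  have "(\<Sum>k\<in>parents E i. partial_deriv k (f i) (pa E i x) * axis j 1 $ k)
      = (if i \<in> children E j then partial_deriv j (f i) (pa E i x) else 0)" for i
    by (simp add: axis_def children_def if_distrib [of "\<lambda>c. _ * c"] cong: if_cong)
  then have "L (axis j 1) = (\<Sum>i\<in>UNIV. (if i = j then deriv ?l (?u i x) else 0)) -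
      (\<Sum>i\<in>UNIV. if i \<in> children E j then partial_deriv j (f i) (pa E i x) * deriv ?l (?u i x) else 0)"
    unfolding L_def sum_subtractf [symmetric]
    by (intro sum.cong) (auto simp: axis_def algebra_simps)
  also have "\<dots> = deriv ?l (?u j x) - (\<Sum>i\<in>children E j. partial_deriv j (f i) (pa E i x) * deriv ?l (?u i x))"
    by (simp add: sum.If_cases)
  finally show ?thesis
    using deriv score by (auto simp: differentiable_def)
qed

end
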